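(* Let $H\in(0,1)$ and $\alpha\in(0,1)$. The solution to $$ \begin{cases} {}^C\left(t^{1-2H}\frac{\partial}{\partial t}\right)^{\alpha} u_{\alpha}(x,t)= H^{\alpha}\,\frac{\partial^2}{\partial x^2}u_{\alpha}(x,t), & x\in\mathbb{R},\ t>0,\\ u_{\alpha}(x,0)=\delta(x), \end{cases} $$ can be represented as $$ u_{\alpha}(x,t)=\frac{H\sqrt{2}}{\sqrt{\pi}\,t^H}\int_0^{\infty}z^{2H-1}\, e^{-\frac{1}{8}\left(\frac{z}{\sqrt{t}}\right)^{4H}}\,u_{2\alpha}(x,z)\,\mathrm{d}z, $$ where $u_{2\alpha}$ is the solution to $$ \begin{cases} {}^C\left(t^{1-2H}\frac{\partial}{\partial t}\right)^{2\alpha} u_{2\alpha}(x,t)= H^{2\alpha}\,\frac{\partial^2}{\partial x^2}u_{2\alpha}(x,t),\\ u_{2\alpha}(x,0)=\delta(x), \end{cases} $$ if $\alpha\in\left(0,\tfrac12\right]$, and the solution to $$ \begin{cases} {}^C\left(t^{1-2H}\frac{\partial}{\partial t}\right)^{2\alpha} u_{2\alpha}(x,t)= H^{2\alpha}\,\frac{\partial^2}{\partial x^2}u_{2\alpha}(x,t),\\ u_{2\alpha}(x,0)=\delta(x),\\ \frac{\partial}{\partial t}u_{2\alpha}(x,t)\big|_{t=0}=0, \end{cases} $$ if $\alpha\in\left(\tfrac12,1\right)$.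
   Context: $\delta$ is the Dirac delta at $0$. Erdélyi–Kober operators: for $m>0$, $\eta\in\mathbb{R}$ and $a>0$, $$(I_m^{\eta,a}f)(t)=\frac{t^{-m\eta-ma}}{\Gamma(a)}\int_0^t (t^m-s^m)^{a-1}s^{m\eta}f(s)\,\mathrm{d}(s^m),$$ and for $a\le 0$, recursively, $I_m^{\eta,a}f=(\eta+a+1)I_m^{\eta,a+1}f+\frac1m I_m^{\eta,a+1}\left(t\frac{\mathrm{d}f}{\mathrm{d}t}\right)$. For $\theta>0$ the fractional power (McBride) of $t^{1-2H}\frac{\mathrm d}{\mathrm dt}$ is $$\left(t^{1-2H}\frac{\mathrm d}{\mathrm dt}\right)^{\theta}f(t)=(2H)^{\theta}t^{-2H\theta}\,(I_{2H}^{0,-\theta}f)(t),$$ and its regularized Caputo-like counterpart is $${}^C\left(t^{1-2H}\frac{\mathrm d}{\mathrm dt}\right)^{\theta}f(t)=\left(t^{1-2H}\frac{\mathrm d}{\mathrm dt}\right)^{\theta}\left(f(t)-\sum_{k=0}^{\lceil\theta\rceil-1}\frac{t^k}{k!}f^{(k)}(0^+)\right).$$ These operators act in the variable $t$. Convention on "the solution": for an order $\theta\in(0,2)$, the solution $u_\theta$ of the Cauchy problem $${}^C\left(t^{1-2H}\frac{\partial}{\partial t}\right)^{\theta}u_\theta(x,t)=H^\theta\frac{\partial^2}{\partial x^2}u_\theta(x,t),\quad x\in\mathbb R,\ t>0,\qquad u_\theta(x,0)=\delta(x),$$ with the additional initial condition $\frac{\partial}{\partial t}u_\theta(x,t)\big|_{t=0}=0$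 when $\theta\in(1,2)$, is the function with spatial Fourier transform $$\int_{\mathbb R}e^{i\beta x}u_\theta(x,t)\,\mathrm dx=E_{\theta,1}\left(-\frac{\beta^2t^{2H\theta}}{2^\theta}\right),\qquad E_{\theta,1}(z)=\sum_{k=0}^\infty\frac{z^k}{\Gamma(\theta k+1)},$$ that is, $$u_\theta(x,t)=\frac{1}{2^{1-\theta/2}t^{H\theta}}W_{-\theta/2,1-\theta/2}\left(-\frac{2^{\theta/2}|x|}{t^{H\theta}}\right),\qquad W_{\gamma,\beta}(x)=\sum_{k=0}^\infty\frac{x^k}{k!\,\Gamma(\gamma k+\beta)}\quad(\gamma>-1,\ \beta>0),$$ with $1/\Gamma=0$ at the poles of $\Gamma$. *)

theory Defs
  imports "HOL-Analysis.Analysis"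
begin

text \<open>The Stieltjes differential \<open>d(s^m)\<close> is written out as \<open>m * s powr (m - 1) ds\<close>.\<close>

function erdelyi_kober ::
    "real \<Rightarrow> real \<Rightarrow> real \<Rightarrow> (real \<Rightarrow> real) \<Rightarrow> real \<Rightarrow> real" where
  "erdelyi_kober m \<eta> a f t =
    (if a > 0
     then t powr (- m * \<eta> - m * a) / Gamma a *
            (LINT s:{0<..<t}|lborel.
               (t powr m - s powr m) powr (a - 1) * s powr (m * \<eta>) * f s
                 * (m * s powr (m - 1)))
     else (\<eta> + a + 1) * erdelyi_kober m \<eta> (a + 1) f t
            + 1 / m * erdelyi_kober m \<eta> (a + 1) (\<lambda>s. s * deriv f s) t)"
  by pat_completeness auto
termination
  by (relation "Wellfounded.measure (\<lambda>(m, \<eta>, a, f, t). nat (1 - \<lfloor>a\<rfloor>))") auto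

declare erdelyi_kober.simps [simp del]

text \<open>The fractional power of order \<open>\<theta>\<close> of \<open>t powr (1 - 2 * H) * d/dt\<close>.\<close>

definition frac_power :: "real \<Rightarrow> real \<Rightarrow> (real \<Rightarrow> real) \<Rightarrow> real \<Rightarrow> real" where
  "frac_power H \<theta> f t =
     (2 * H) powr \<theta> * t powr (- 2 * H * \<theta>) * erdelyi_kober (2 * H) 0 (- \<theta>) f t"

definition caputo_frac_power :: "real \<Rightarrow> real \<Rightarrow> (real \<Rightarrow> real) \<Rightarrow> real \<Rightarrow> real" where
  "caputo_frac_power H \<theta> f =
     frac_power H \<theta>
       (\<lambda>t. f t - (\<Sum>k<nat \<lceil>\<theta>\<rceil>. t ^ k / fact k * Lim (at_right 0) ((deriv ^^ k) f)))"

definition mittag_leffler :: "real \<Rightarrow> real \<Rightarrow> real" where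
  "mittag_leffler \<theta> z = (\<Sum>k. z ^ k / Gamma (\<theta> * real k + 1))"

text \<open>
  The initial datum is the Dirac delta, attained in the sense of weak convergence as
  \<open>t\<close> tends to \<open>0\<close> from the right. The equation and the condition on the time derivative are
  pointwise, away from the point \<open>x = 0\<close>: for \<open>\<theta> \<noteq> 1\<close> the solution has a kink in \<open>x\<close> there,
  so the second space derivative does not exist at \<open>x = 0\<close>, and \<open>u 0 t\<close> is unbounded
  as \<open>t\<close> tends to \<open>0\<close>.
\<close>

definition solves_cauchy_problem :: "real \<Rightarrow> real \<Rightarrow> (real \<Rightarrow> real \<Rightarrow> real) \<Rightarrow> bool" where
  "solves_cauchy_problem H \<theta> u \<longleftrightarrow>
     (\<forall>x t. x \<noteq> 0 \<longrightarrow> t > 0 \<longrightarrow>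
        caputo_frac_power H \<theta> (\<lambda>s. u x s) t
          = H powr \<theta> * (deriv ^^ 2) (\<lambda>y. u y t) x) \<and>
     (\<forall>\<phi> :: real \<Rightarrow> real. continuous_on UNIV \<phi> \<longrightarrow> bounded (range \<phi>) \<longrightarrow>
        ((\<lambda>t. LINT x|lborel. u x t * \<phi> x) \<longlongrightarrow> \<phi> 0) (at_right 0)) \<and>
     (\<theta> > 1 \<longrightarrow> (\<forall>x. x \<noteq> 0 \<longrightarrow> ((\<lambda>t. deriv (\<lambda>s. u x s) t) \<longlongrightarrow> 0) (at_right 0)))"

text \<open>
  The solution is singled out by its spatial Fourier transform. That determines \<open>u x t\<close> for
  almost every \<open>x\<close> only; continuity in \<open>x\<close> selects the representative given by the Wright
  function, \<open>2 powr (\<theta> / 2 - 1) * t powr (- H * \<theta>) * W (- 2 powr (\<theta> / 2) * \<bar>x\<bar> / t powr (H * \<theta>))\<close>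
  with \<open>W\<close> of parameters \<open>- \<theta> / 2\<close> and \<open>1 - \<theta> / 2\<close>.
\<close>

definition is_the_solution :: "real \<Rightarrow> real \<Rightarrow> (real \<Rightarrow> real \<Rightarrow> real) \<Rightarrow> bool" where
  "is_the_solution H \<theta> u \<longleftrightarrow>
     solves_cauchy_problem H \<theta> u \<and>
     (\<forall>t>0. continuous_on UNIV (\<lambda>x. u x t) \<and>
            integrable lborel (\<lambda>x. u x t) \<and>
            (\<forall>\<beta>::real. (LINT x|lborel. exp (\<i> * complex_of_real (\<beta> * x)) * complex_of_real (u x t))
               = complex_of_real
                   (mittag_leffler \<theta> (- (\<beta>\<^sup>2 * t powr (2 * H * \<theta>) / 2 powr \<theta>)))))"

end

theory Submission
  imports Defs "HOL-Probability.Levy"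
begin

text \<open>
  Taking Fourier transforms in \<open>x\<close> turns the claim into a scalar identity between
  Mittag-Leffler functions. In the variable \<open>w = z powr (2 * H)\<close> the integral over \<open>z\<close> becomes
  a Gaussian average over the half line, and the transform of \<open>u\<^sub>2\<^sub>\<alpha>\<close> becomes
  \<open>mittag_leffler (2 * \<alpha>) (b * w powr (2 * \<alpha>))\<close>. The Gaussian moment of order \<open>2 * \<alpha> * k\<close> is
  \<open>Gamma (\<alpha> * k + 1 / 2)\<close> up to elementary factors, and Legendre's duplication formula says that dividing
  it by \<open>Gamma (2 * \<alpha> * k + 1)\<close> leaves \<open>1 / Gamma (\<alpha> * k + 1)\<close>. So the Gaussian average
  of the Mittag-Leffler function of order \<open>2 * \<alpha>\<close> is a multiple of the one of order \<open>\<alpha>\<close>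
  (lemma \<open>mittag_leffler_subordination\<close>); this is where the order is halved.

  Going back from transforms to functions rests on three points. First, an integrable continuous
  function is determined by its transform (lemma \<open>fourier_unique\<close>, from the uniqueness theorem
  for characteristic functions). Applied to \<open>u\<^sub>2\<^sub>\<alpha>\<close> itself, it gives the self-similarity
  \<open>u x t = \<phi> (x / t powr (2 * H * \<alpha>)) / t powr (2 * H * \<alpha>)\<close> with \<open>\<phi> = (\<lambda>x. u x 1)\<close>. The integral in
  the theorem is therefore a mixture of dilates of a single integrable continuous function \<open>\<phi>\<close>,
  the function \<open>scale_mixture\<close> below. Second, Fubini applies to the mixture, because all dilates
  have the same \<open>L\<^sup>1\<close> norm. Third, to have equality at every \<open>x\<close> and not just almost everywhere,
  the mixture must exist everywhere and be continuous. The difficulty is the end \<open>w \<rightarrow> 0\<close>, where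
  \<open>\<phi>\<close> is evaluated at large arguments; no bound on \<open>\<phi>\<close> is at hand there, only integrability.
  Taking the argument \<open>y\<close> of \<open>\<phi>\<close> as the variable of integration settles this for \<open>x \<noteq> 0\<close>,
  since the kernel facing \<open>\<phi>\<close> is then bounded. At \<open>x = 0\<close>, the part \<open>\<bar>y\<bar> > 1\<close> is at most a multiple
  of \<open>\<bar>x\<bar> powr (1 / \<alpha> - 1)\<close>, which vanishes with \<open>x\<close> because \<open>\<alpha> < 1\<close>, and on the part
  \<open>\<bar>y\<bar> \<le> 1\<close> the function \<open>\<phi>\<close> is bounded.
\<close>

section \<open>Uniqueness of Fourier transforms\<close>

definition fourier :: "(real \<Rightarrow> real) \<Rightarrow> real \<Rightarrow> complex" where
  "fourier f \<beta> = (LINT x|lborel. exp (\<i> * complex_of_real (\<beta> * x)) * complex_of_real (f x))"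

lemma integrable_fourier:
  assumes "integrable lborel f"
  shows "integrable lborel (\<lambda>x. exp (\<i> * complex_of_real (\<beta> * x)) * complex_of_real (f x))"
proof (rule Bochner_Integration.integrable_bound[OF assms])
  have [measurable]: "f \<in> borel_measurable borel" using assms by auto
  show "(\<lambda>x. exp (\<i> * complex_of_real (\<beta> * x)) * complex_of_real (f x)) \<in> borel_measurable lborel"
    by measurable
qed (simp add: norm_mult)

lemma fourier_0: "fourier f 0 = complex_of_real (LINT x|lborel. f x)"
  by (simp add: fourier_def)

lemma fourier_add:
  assumes "integrable lborel f" "integrable lborel g"
  shows "fourier (\<lambda>x. f x + g x) \<beta> = fourier f \<beta> + fourier g \<beta>"
  using integrable_fourier[OF assms(1), of \<beta>] integrable_fourier[OF assms(2), of \<beta>]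
  by (simp add: fourier_def distrib_left)

lemma fourier_scale:
  assumes p: "p > 0"
  shows "fourier (\<lambda>x. f (x / p) / p) \<beta> = fourier f (\<beta> * p)"
proof -
  let ?F = "\<lambda>x. exp (\<i> * complex_of_real (\<beta> * x)) * complex_of_real (f (x / p) / p)"
  have "fourier (\<lambda>x. f (x / p) / p) \<beta> = \<bar>p\<bar> *\<^sub>R (LINT x|lborel. ?F (0 + p * x))"
    unfolding fourier_def using p by (intro lborel_integral_real_affine) simp
  also have "\<dots> = (LINT x|lborel. p *\<^sub>R ?F (0 + p * x))"
    using p by simp
  also have "\<dots> = fourier f (\<beta> * p)"
    unfolding fourier_def
    by (intro Bochner_Integration.integral_cong) (use p in \<open>auto simp: scaleR_conv_of_real mult_ac\<close>)
  finally show ?thesis .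
qed

text \<open>
  Both functions have the same integral, namely the transform at \<open>0\<close>. If it is positive, dividing by it
  gives two probability densities with the same characteristic function, and
  \<open>Levy_uniqueness\<close> applies.
\<close>

lemma fourier_unique_AE_nonneg:
  assumes f: "integrable lborel f" and g: "integrable lborel g"
    and nn: "\<And>x. f x \<ge> 0" "\<And>x. g x \<ge> 0"
    and eq: "\<And>\<beta>. fourier f \<beta> = fourier g \<beta>"
  shows "AE x in lborel. f x = g x"
proof -
  have [measurable]: "f \<in> borel_measurable borel" "g \<in> borel_measurable borel"
    using f g by auto
  define m where "m = (LINT x|lborel. f x)"
  have mg: "m = (LINT x|lborel. g x)"
    using eq[of 0] by (simp add: fourier_0 m_def)
  show ?thesis
  proof (cases "m = 0")
    case True
    then have "AE x in lborel. f x = 0" "AE x in lborel. g x = 0"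
      using integral_nonneg_eq_0_iff_AE[OF f] integral_nonneg_eq_0_iff_AE[OF g] nn mg
      by (auto simp: m_def)
    then show ?thesis by eventually_elim simp
  next
    case False
    then have m: "m > 0" using nn by (simp add: m_def less_le)
    have dist: "real_distribution (density lborel (\<lambda>x. ennreal (h x / m)))"
      if h: "integrable lborel h" and hn: "\<And>x. h x \<ge> 0" and hm: "m = (LINT x|lborel. h x)" for h
    proof -
      have [measurable]: "h \<in> borel_measurable borel" using h by auto
      have "(\<integral>\<^sup>+ x. ennreal (h x / m) \<partial>lborel) = ennreal (LINT x|lborel. h x / m)"
        using h hn m by (intro nn_integral_eq_integral) auto
      also have "\<dots> = 1" using m hm by simp
      finally have "prob_space (density lborel (\<lambda>x. ennreal (h x / m)))"
        by (intro prob_spaceI) (simp add: emeasure_density)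
      then show ?thesis
        by (simp add: real_distribution_def real_distribution_axioms_def)
    qed
    have ch: "char (density lborel (\<lambda>x. ennreal (h x / m))) \<beta> = fourier h \<beta> / m"
      if h: "integrable lborel h" and hn: "\<And>x. h x \<ge> 0" for h \<beta>
    proof -
      have [measurable]: "h \<in> borel_measurable borel" using h by auto
      have "char (density lborel (\<lambda>x. ennreal (h x / m))) \<beta> =
          (LINT x|lborel. (h x / m) *\<^sub>R iexp (\<beta> * x))"
        unfolding char_def using hn m by (subst integral_density) auto
      also have "\<dots> = (LINT x|lborel. (exp (\<i> * complex_of_real (\<beta> * x)) * complex_of_real (h x)) / m)"
        by (intro Bochner_Integration.integral_cong) (auto simp: scaleR_conv_of_real mult_ac)
      finally show ?thesis by (simp add: fourier_def)
    qed
    have "density lborel (\<lambda>x. ennreal (f x / m)) = density lborel (\<lambda>x. ennreal (g x / m))"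
      by (intro Levy_uniqueness dist f g nn mg m_def ext) (simp add: ch f g nn eq)
    then have "AE x in lborel. ennreal (f x / m) = ennreal (g x / m)"
      by (intro sigma_finite_measure.density_unique[OF lborel.sigma_finite_measure_axioms]) auto
    then show ?thesis
      by eventually_elim (use nn m in auto)
  qed
qed

text \<open>
  The nonnegative case is applied to the two sides of
  \<open>f\<^sup>+ + g\<^sup>- = g\<^sup>+ + f\<^sup>-\<close>, which is \<open>f = g\<close> with the negative parts moved across.
\<close>

lemma fourier_unique_AE:
  assumes f: "integrable lborel f" and g: "integrable lborel g"
    and eq: "\<And>\<beta>. fourier f \<beta> = fourier g \<beta>"
  shows "AE x in lborel. f x = g x"
proof -
  have "AE x in lborel. max 0 (f x) + max 0 (- g x) = max 0 (g x) + max 0 (- f x)"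
  proof (rule fourier_unique_AE_nonneg)
    fix \<beta>
    have split: "fourier h \<beta> + fourier (\<lambda>x. max 0 (- h x)) \<beta> = fourier (\<lambda>x. max 0 (h x)) \<beta>"
      if "integrable lborel h" for h
    proof -
      have "(\<lambda>x. h x + max 0 (- h x)) = (\<lambda>x. max 0 (h x))" by (auto simp: max_def)
      then show ?thesis using fourier_add[of h "\<lambda>x. max 0 (- h x)" \<beta>] that by simp
    qed
    have "fourier (\<lambda>x. max 0 (f x)) \<beta> + fourier (\<lambda>x. max 0 (- g x)) \<beta> =
        fourier (\<lambda>x. max 0 (g x)) \<beta> + fourier (\<lambda>x. max 0 (- f x)) \<beta>"
      by (simp add: split[OF f, symmetric] split[OF g, symmetric] eq add_ac)
    then show "fourier (\<lambda>x. max 0 (f x) + max 0 (- g x)) \<beta> =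
        fourier (\<lambda>x. max 0 (g x) + max 0 (- f x)) \<beta>"
      using f g by (simp add: fourier_add)
  qed (use f g in auto)
  then show ?thesis by eventually_elim (auto simp: max_def split: if_splits)
qed

text \<open>
  For continuous functions the exceptional set is open, and an open null set is empty.
\<close>

lemma fourier_unique:
  assumes "integrable lborel f" "integrable lborel g"
    and c: "continuous_on UNIV f" "continuous_on UNIV g"
    and "\<And>\<beta>. fourier f \<beta> = fourier g \<beta>"
  shows "f = g"
proof -
  have ae: "AE x in lborel. f x = g x" by (rule fourier_unique_AE) fact+
  have op: "open {x. f x \<noteq> g x}" by (rule open_Collect_neq) fact+
  then have "{x. f x \<noteq> g x} \<in> null_sets lborel"
    using ae by (subst AE_iff_null_sets) auto
  then have "negligible {x. f x \<noteq> g x}"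
    by (simp add: negligible_iff_null_sets null_sets_completionI)
  then show ?thesis using open_not_negligible[OF op] by auto
qed

section \<open>Power substitutions and Gaussian moments\<close>

text \<open>
  The map \<open>w \<mapsto> a * w powr p\<close> is a bijection of the half line for either sign of \<open>p\<close>. Three instances
  are used: \<open>p = 2\<close> turns Gaussian moments into Gamma integrals, \<open>p = 2 * H\<close> passes from \<open>z\<close> to
  \<open>w\<close>, and \<open>p = - \<alpha>\<close> makes the argument of a dilated function the variable of integration.
\<close>

lemma power_substitution:
  fixes f :: "real \<Rightarrow> real"
  assumes [measurable]: "f \<in> borel_measurable borel" and a: "a > 0" and p: "p \<noteq> 0"
  shows set_integrable_power_substitution:
    "set_integrable lborel {0<..} (\<lambda>w. a * \<bar>p\<bar> * w powr (p - 1) * f (a * w powr p)) \<longleftrightarrow>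
     set_integrable lborel {0<..} f" (is "?I \<longleftrightarrow> ?J")
    and set_integral_power_substitution:
    "(LINT w:{0<..}|lborel. a * \<bar>p\<bar> * w powr (p - 1) * f (a * w powr p)) =
     (LINT w:{0<..}|lborel. f w)"
proof -
  let ?h = "\<lambda>w. a * \<bar>p\<bar> * w powr (p - 1) * f (a * w powr p)"
  have img: "(\<lambda>w. a * w powr p) ` {0<..} = {0<..}"
  proof (intro equalityI subsetI)
    fix y :: real assume y: "y \<in> {0<..}"
    then have "y = a * ((y / a) powr (1 / p)) powr p"
      using a p by (simp add: powr_powr)
    moreover have "(y / a) powr (1 / p) \<in> {0<..}" using y a by simp
    ultimately show "y \<in> (\<lambda>w. a * w powr p) ` {0<..}" by blast
  qed (use a in auto)
  have inj: "inj_on (\<lambda>w. a * w powr p) {0<..}"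
  proof (rule inj_onI)
    fix x y :: real assume xy: "x \<in> {0<..}" "y \<in> {0<..}" "a * x powr p = a * y powr p"
    then have "(x powr p) powr (1 / p) = (y powr p) powr (1 / p)" using a by simp
    with xy p show "x = y" by (simp add: powr_powr)
  qed
  have der: "((\<lambda>w. a * w powr p) has_field_derivative a * p * x powr (p - 1)) (at x within {0<..})"
    if "x \<in> {0<..}" for x
    using that by (auto intro!: derivative_eq_intros simp: powr_diff)
  have abs: "\<bar>a * p * x powr (p - 1)\<bar> = a * \<bar>p\<bar> * x powr (p - 1)" for x
    using a by (simp add: abs_mult)
  have leb: "set_integrable lebesgue {0<..} g \<longleftrightarrow> set_integrable lborel {0<..} g"
    if "g \<in> borel_measurable borel" for g :: "real \<Rightarrow> real"
    unfolding set_integrable_def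
    by (rule integrable_completion) (use that in measurable)
  have cv: "?h absolutely_integrable_on {0<..} \<and> integral {0<..} ?h = b \<longleftrightarrow>
      f absolutely_integrable_on {0<..} \<and> integral {0<..} f = b" for b
    using has_absolute_integral_change_of_variables_1'[of "{0<..}" "\<lambda>w. a * w powr p"
        "\<lambda>x. a * p * x powr (p - 1)" f b] der inj
    unfolding img abs by simp
  have hm: "?h \<in> borel_measurable borel" by measurable
  show eqv: "?I \<longleftrightarrow> ?J"
    using cv leb[OF hm] leb[OF assms(1)] by blast
  show "(LINT w:{0<..}|lborel. ?h w) = (LINT w:{0<..}|lborel. f w)"
  proof (cases ?J)
    case True
    then have "?I" using eqv by simp
    have "integral {0<..} ?h = integral {0<..} f"
      using cv[of "integral {0<..} f"] leb[OF assms(1)] True by blast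
    then show ?thesis
      using set_borel_integral_eq_integral(2)[OF True] set_borel_integral_eq_integral(2)[OF \<open>?I\<close>]
      by simp
  next
    case False
    then have "\<not> ?I" using eqv by simp
    with False show ?thesis
      unfolding set_lebesgue_integral_def set_integrable_def
      by (simp add: not_integrable_integral_eq)
  qed
qed

lemma gaussian_moment:
  fixes c s :: real
  assumes c: "c > 0" and s: "s > -1"
  shows "set_integrable lborel {0<..} (\<lambda>w. exp (- c * w\<^sup>2) * w powr s)"
    and "(LINT w:{0<..}|lborel. exp (- c * w\<^sup>2) * w powr s) =
           Gamma ((s + 1) / 2) / (2 * c powr ((s + 1) / 2))"
proof -
  define q where "q = (s + 1) / 2"
  define K where "K = 1 / (2 * c powr q)"
  have q: "q > 0" using s by (simp add: q_def)
  \<comment> \<open>The substitution \<open>y = c * w\<^sup>2\<close> turns \<open>f\<close>, a multiple of the Gamma integrand, into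
  the integrand of the moment.\<close>
  define f where "f = (\<lambda>y::real. K * (y powr (q - 1) / exp y))"
  have fm: "f \<in> borel_measurable borel" unfolding f_def by measurable
  have gi: "((\<lambda>t. t powr (q - 1) / exp t) has_integral Gamma q) {0<..}"
    using Gamma_integral_real[OF q]
    by (subst has_integral_spike_set_eq[of _ "{0..}"]) (auto intro: negligible_subset[of "{0}"])
  then have "(\<lambda>t. t powr (q - 1) / exp t) absolutely_integrable_on {0<..}"
    by (intro nonnegative_absolutely_integrable_1) (auto simp: integrable_on_def)
  then have gl: "set_integrable lborel {0<..} (\<lambda>t. t powr (q - 1) / exp t)"
    unfolding set_integrable_def by (subst (asm) integrable_completion) auto
  then have fi: "set_integrable lborel {0<..} f"
    unfolding f_def by (intro set_integrable_mult_right) simp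
  have fv: "(LINT y:{0<..}|lborel. f y) = K * Gamma q"
    using set_borel_integral_eq_integral(2)[OF gl] gi unfolding f_def
    by (simp add: integral_unique del: times_divide_eq_right)
  have eq: "c * \<bar>2\<bar> * w powr (2 - 1) * f (c * w powr 2) = exp (- c * w\<^sup>2) * w powr s"
    if w: "w \<in> {0<..}" for w
  proof -
    have "(c * w powr 2) powr (q - 1) = c powr (q - 1) * w powr (s - 1)"
    proof -
      have "2 * (q - 1) = s - 1" by (simp add: q_def field_simps)
      then show ?thesis using c w by (simp add: powr_mult powr_powr del: powr_numeral)
    qed
    then have "c * \<bar>2\<bar> * w powr (2 - 1) * f (c * w powr 2) =
        (2 * K * (c * c powr (q - 1))) * (w * w powr (s - 1)) * exp (- c * w\<^sup>2)"
      using w by (simp add: f_def exp_minus field_simps)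
    also have "c * c powr (q - 1) = c powr q" using c by (simp add: powr_mult_base)
    also have "w * w powr (s - 1) = w powr s" using w by (simp add: powr_mult_base)
    also have "2 * K * c powr q = 1" using c by (simp add: K_def)
    finally show ?thesis by simp
  qed
  show "set_integrable lborel {0<..} (\<lambda>w. exp (- c * w\<^sup>2) * w powr s)"
    using iffD2[OF set_integrable_power_substitution[OF fm c, of 2] fi]
    by (rule iffD1[OF set_integrable_cong[OF refl refl eq], rotated -1]) simp_all
  have "(LINT w:{0<..}|lborel. exp (- c * w\<^sup>2) * w powr s) =
      (LINT w:{0<..}|lborel. c * \<bar>2\<bar> * w powr (2 - 1) * f (c * w powr 2))"
    by (rule set_lebesgue_integral_cong) (use eq in auto)
  also have "\<dots> = (LINT y:{0<..}|lborel. f y)"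
    by (rule set_integral_power_substitution[OF fm c]) simp
  finally show "(LINT w:{0<..}|lborel. exp (- c * w\<^sup>2) * w powr s) =
           Gamma ((s + 1) / 2) / (2 * c powr ((s + 1) / 2))"
    by (simp add: fv K_def q_def)
qed


section \<open>Mixtures of dilates of an integrable function\<close>

text \<open>
  The dilates \<open>\<lambda>x. \<phi> (x / p) / p\<close> with \<open>p = w powr \<alpha>\<close>, which all have the \<open>L\<^sup>1\<close> norm of \<open>\<phi>\<close>, are
  averaged against the Gaussian weight \<open>exp (- c * w\<^sup>2)\<close>.
\<close>

definition scale_mixture :: "real \<Rightarrow> real \<Rightarrow> (real \<Rightarrow> real) \<Rightarrow> real \<Rightarrow> real" where
  "scale_mixture \<alpha> c \<phi> x =
     (LINT w:{0<..}|lborel. exp (- c * w\<^sup>2) * (\<phi> (x / w powr \<alpha>) / w powr \<alpha>))"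

lemma scale_mixture_uminus:
  "scale_mixture \<alpha> c \<phi> (- x) = scale_mixture \<alpha> c (\<lambda>y. \<phi> (- y)) x"
  by (simp add: scale_mixture_def)

text \<open>
  Fubini's theorem applies because the inner integral of the absolute value over \<open>x\<close> is the
  Gaussian weight times the \<open>L\<^sup>1\<close> norm of \<open>\<phi>\<close>, and dilation by \<open>p\<close> becomes multiplication by \<open>p\<close> of
  the Fourier variable.
\<close>

lemma scale_mixture_fourier:
  assumes \<phi>: "integrable lborel \<phi>" and c: "c > 0"
  shows integrable_scale_mixture: "integrable lborel (scale_mixture \<alpha> c \<phi>)"
    and fourier_scale_mixture: "fourier (scale_mixture \<alpha> c \<phi>) \<beta> =
      (LINT w:{0<..}|lborel. complex_of_real (exp (- c * w\<^sup>2)) * fourier \<phi> (\<beta> * w powr \<alpha>))"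
proof -
  have [measurable]: "\<phi> \<in> borel_measurable borel" using \<phi> by auto
  define F :: "real \<Rightarrow> real \<Rightarrow> real"
    where "F w x = indicator {0<..} w * (exp (- c * w\<^sup>2) * (\<phi> (x / w powr \<alpha>) / w powr \<alpha>))" for w x
  have Fm [measurable]: "case_prod F \<in> borel_measurable (lborel \<Otimes>\<^sub>M lborel)"
    unfolding F_def by measurable
  have abs_int: "(LINT x|lborel. \<bar>\<phi> (x / p) / p\<bar>) = (LINT x|lborel. \<bar>\<phi> x\<bar>)"
    and scaled_int: "integrable lborel (\<lambda>x. \<phi> (x / p) / p)" if "p > 0" for p :: real
  proof -
    show "integrable lborel (\<lambda>x. \<phi> (x / p) / p)"
      using lborel_integrable_real_affine[OF \<phi>, of "1 / p" 0] that by simp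
    show "(LINT x|lborel. \<bar>\<phi> (x / p) / p\<bar>) = (LINT x|lborel. \<bar>\<phi> x\<bar>)"
      using lborel_integral_real_affine[of "1 / p" "\<lambda>x. \<bar>\<phi> x\<bar>" 0] that by (simp add: abs_mult)
  qed
  have intF: "integrable (lborel \<Otimes>\<^sub>M lborel) (case_prod F)"
  proof (rule lborel_pair.Fubini_integrable[OF Fm])
    have "(LINT x|lborel. norm (case_prod F (w, x))) =
        indicator {0<..} w *\<^sub>R (exp (- c * w\<^sup>2) * w powr 0) * (LINT x|lborel. \<bar>\<phi> x\<bar>)" for w
    proof (cases "w > 0")
      case True
      have "(LINT x|lborel. norm (case_prod F (w, x))) =
          (LINT x|lborel. exp (- c * w\<^sup>2) * \<bar>\<phi> (x / w powr \<alpha>) / w powr \<alpha>\<bar>)"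
        using True by (intro Bochner_Integration.integral_cong) (auto simp: F_def abs_mult)
      also have "\<dots> = exp (- c * w\<^sup>2) * (LINT x|lborel. \<bar>\<phi> (x / w powr \<alpha>) / w powr \<alpha>\<bar>)"
        by (rule integral_mult_right_zero)
      also have "\<dots> = exp (- c * w\<^sup>2) * (LINT x|lborel. \<bar>\<phi> x\<bar>)"
        using True by (subst abs_int) auto
      finally show ?thesis using True by simp
    qed (simp add: F_def)
    then show "integrable lborel (\<lambda>w. LINT x|lborel. norm (case_prod F (w, x)))"
      using gaussian_moment(1)[OF c, of 0] unfolding set_integrable_def by simp
    show "AE w in lborel. integrable lborel (\<lambda>x. case_prod F (w, x))"
    proof (intro AE_I2)
      fix w :: real
      show "integrable lborel (\<lambda>x. case_prod F (w, x))"
      proof (cases "w > 0")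
        case True
        then have "integrable lborel (\<lambda>x. exp (- c * w\<^sup>2) * (\<phi> (x / w powr \<alpha>) / w powr \<alpha>))"
          using scaled_int[of "w powr \<alpha>"] by (intro integrable_mult_right) simp
        then show ?thesis using True by (simp add: F_def)
      qed (simp add: F_def)
    qed
  qed
  have mix: "scale_mixture \<alpha> c \<phi> = (\<lambda>x. LINT w|lborel. F w x)"
    by (simp add: scale_mixture_def set_lebesgue_integral_def F_def fun_eq_iff)
  show "integrable lborel (scale_mixture \<alpha> c \<phi>)"
    unfolding mix by (rule lborel_pair.integrable_snd[OF intF])
  let ?e = "\<lambda>x. exp (\<i> * complex_of_real (\<beta> * x))"
  have intE: "integrable (lborel \<Otimes>\<^sub>M lborel) (\<lambda>(w, x). ?e x * complex_of_real (F w x))"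
  proof (rule Bochner_Integration.integrable_bound[OF intF])
    show "(\<lambda>(w, x). ?e x * complex_of_real (F w x)) \<in> borel_measurable (lborel \<Otimes>\<^sub>M lborel)"
      by measurable
  qed (auto simp: norm_mult)
  have "fourier (scale_mixture \<alpha> c \<phi>) \<beta> = (LINT x|lborel. LINT w|lborel. ?e x * complex_of_real (F w x))"
    by (simp add: fourier_def mix)
  also have "\<dots> = (LINT w|lborel. LINT x|lborel. ?e x * complex_of_real (F w x))"
    by (rule lborel_pair.Fubini_integral[OF intE])
  also have "\<dots> = (LINT w|lborel. indicator {0<..} w *\<^sub>R (complex_of_real (exp (- c * w\<^sup>2)) * fourier \<phi> (\<beta> * w powr \<alpha>)))"
  proof (intro Bochner_Integration.integral_cong refl)
    fix w :: real
    show "(LINT x|lborel. ?e x * complex_of_real (F w x)) =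
        indicator {0<..} w *\<^sub>R (complex_of_real (exp (- c * w\<^sup>2)) * fourier \<phi> (\<beta> * w powr \<alpha>))"
    proof (cases "w > 0")
      case True
      have "(LINT x|lborel. ?e x * complex_of_real (F w x)) =
          (LINT x|lborel. complex_of_real (exp (- c * w\<^sup>2)) * (?e x * complex_of_real (\<phi> (x / w powr \<alpha>) / w powr \<alpha>)))"
        using True by (intro Bochner_Integration.integral_cong) (auto simp: F_def)
      also have "\<dots> = complex_of_real (exp (- c * w\<^sup>2)) * fourier (\<lambda>x. \<phi> (x / w powr \<alpha>) / w powr \<alpha>) \<beta>"
        unfolding fourier_def by (rule integral_mult_right_zero)
      finally show ?thesis using True by (simp add: fourier_scale)
    qed (simp add: F_def)
  qed
  finally show "fourier (scale_mixture \<alpha> c \<phi>) \<beta> =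
      (LINT w:{0<..}|lborel. complex_of_real (exp (- c * w\<^sup>2)) * fourier \<phi> (\<beta> * w powr \<alpha>))"
    by (simp add: set_lebesgue_integral_def)
qed

text \<open>
  The substitution \<open>y = x / w powr \<alpha>\<close>. Afterwards \<open>g\<close> is integrated against a kernel that
  is bounded as long as \<open>x\<close> stays away from \<open>0\<close>, so for integrable \<open>g\<close> the integral exists,
  and the dependence on \<open>x\<close> sits in the smooth kernel.
\<close>

lemma scale_mixture_kernel:
  fixes g :: "real \<Rightarrow> real"
  assumes [measurable]: "g \<in> borel_measurable borel" and \<alpha>: "\<alpha> > 0" and x: "x > 0"
  shows set_integrable_scale_mixture_kernel:
    "set_integrable lborel {0<..} (\<lambda>w. exp (- c * w\<^sup>2) * (g (x / w powr \<alpha>) / w powr \<alpha>)) \<longleftrightarrow>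
     set_integrable lborel {0<..} (\<lambda>y. y powr (- 1 / \<alpha>) * exp (- c * (x / y) powr (2 / \<alpha>)) * g y)"
    and scale_mixture_eq_kernel:
    "scale_mixture \<alpha> c g x = x powr (1 / \<alpha> - 1) / \<alpha> *
       (LINT y:{0<..}|lborel. y powr (- 1 / \<alpha>) * exp (- c * (x / y) powr (2 / \<alpha>)) * g y)"
proof -
  define C where "C = x powr (1 / \<alpha> - 1) / \<alpha>"
  have C: "C \<noteq> 0" using \<alpha> x by (simp add: C_def)
  define k where "k = (\<lambda>y. y powr (- 1 / \<alpha>) * exp (- c * (x / y) powr (2 / \<alpha>)) * g y)"
  define f where "f = (\<lambda>y. C * k y)"
  have fm: "f \<in> borel_measurable borel" unfolding f_def k_def by measurable
  have eq: "x * \<bar>- \<alpha>\<bar> * w powr (- \<alpha> - 1) * f (x * w powr (- \<alpha>)) =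
      exp (- c * w\<^sup>2) * (g (x / w powr \<alpha>) / w powr \<alpha>)" if "w \<in> {0<..}" for w
  proof -
    have w: "w > 0" using that by simp
    have 1: "(x * w powr (- \<alpha>)) powr (- 1 / \<alpha>) = x powr (- 1 / \<alpha>) * w"
      using w x \<alpha> by (simp add: powr_mult powr_powr)
    have 2: "(x / (x * w powr (- \<alpha>))) powr (2 / \<alpha>) = w\<^sup>2"
      using w x \<alpha> by (simp add: powr_minus powr_powr field_simps flip: powr_numeral)
    have 3: "x * C * x powr (- 1 / \<alpha>) * \<alpha> = 1"
    proof -
      have "x * x powr (1 / \<alpha> - 1) * x powr (- 1 / \<alpha>) = 1"
        using x by (simp add: powr_mult_base flip: powr_add)
      then show ?thesis using \<alpha> by (simp add: C_def)
    qed
    have 4: "w powr (- \<alpha> - 1) * w = 1 / w powr \<alpha>"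
      using w by (simp add: powr_diff powr_minus field_simps)
    have "x * \<bar>- \<alpha>\<bar> * w powr (- \<alpha> - 1) * f (x * w powr (- \<alpha>)) =
       (x * C * x powr (- 1 / \<alpha>) * \<alpha>) * (w powr (- \<alpha> - 1) * w) *
         (exp (- c * w\<^sup>2) * g (x * w powr (- \<alpha>)))"
      unfolding f_def k_def 1 2 using \<alpha> by (simp only: abs_minus_cancel abs_of_pos mult_ac)
    then show ?thesis by (simp only: 3 4) (simp add: powr_minus field_simps)
  qed
  have "set_integrable lborel {0<..} (\<lambda>w. exp (- c * w\<^sup>2) * (g (x / w powr \<alpha>) / w powr \<alpha>)) \<longleftrightarrow>
      set_integrable lborel {0<..} (\<lambda>w. x * \<bar>- \<alpha>\<bar> * w powr (- \<alpha> - 1) * f (x * w powr (- \<alpha>)))"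
    by (rule set_integrable_cong[OF refl refl eq[symmetric]])
  also have "\<dots> \<longleftrightarrow> set_integrable lborel {0<..} f"
    by (rule set_integrable_power_substitution[OF fm x]) (use \<alpha> in simp)
  also have "\<dots> \<longleftrightarrow> set_integrable lborel {0<..} k"
    unfolding f_def using C by (rule set_integrable_mult_right_iff)
  finally show "set_integrable lborel {0<..} (\<lambda>w. exp (- c * w\<^sup>2) * (g (x / w powr \<alpha>) / w powr \<alpha>)) \<longleftrightarrow>
     set_integrable lborel {0<..} (\<lambda>y. y powr (- 1 / \<alpha>) * exp (- c * (x / y) powr (2 / \<alpha>)) * g y)"
    unfolding k_def .
  have "scale_mixture \<alpha> c g x =
      (LINT w:{0<..}|lborel. x * \<bar>- \<alpha>\<bar> * w powr (- \<alpha> - 1) * f (x * w powr (- \<alpha>)))"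
    unfolding scale_mixture_def by (rule set_lebesgue_integral_cong) (use eq in auto)
  also have "\<dots> = (LINT y:{0<..}|lborel. f y)"
    by (rule set_integral_power_substitution[OF fm x]) (use \<alpha> in simp)
  finally show "scale_mixture \<alpha> c g x = x powr (1 / \<alpha> - 1) / \<alpha> *
       (LINT y:{0<..}|lborel. y powr (- 1 / \<alpha>) * exp (- c * (x / y) powr (2 / \<alpha>)) * g y)"
    unfolding f_def k_def C_def by simp
qed

text \<open>
  With \<open>s = y powr (- 1 / \<alpha>)\<close> the kernel is at most \<open>s * exp (- (k * s\<^sup>2))\<close> for
  \<open>k = c * d powr (2 / \<alpha>)\<close>, uniformly for \<open>x \<ge> d\<close>, and this is bounded in \<open>s\<close>.
\<close>

lemma kernel_bound:
  fixes c d x y \<alpha> :: real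
  assumes c: "c > 0" and \<alpha>: "\<alpha> > 0" and d: "0 < d" "d \<le> x" and y: "y > 0"
  shows "y powr (- 1 / \<alpha>) * exp (- c * (x / y) powr (2 / \<alpha>)) \<le> 1 + 1 / (c * d powr (2 / \<alpha>))"
proof -
  define s where "s = y powr (- 1 / \<alpha>)"
  define k where "k = c * d powr (2 / \<alpha>)"
  have k: "k > 0" using c d by (simp add: k_def)
  have s: "s > 0" using y by (simp add: s_def)
  have "k * s\<^sup>2 = c * (d / y) powr (2 / \<alpha>)"
    using d y by (simp add: k_def s_def powr_divide powr_minus powr_powr divide_simps flip: powr_numeral)
  also have "\<dots> \<le> c * (x / y) powr (2 / \<alpha>)"
    using c d y \<alpha> by (intro mult_left_mono powr_mono2 divide_right_mono) auto
  finally have "exp (- c * (x / y) powr (2 / \<alpha>)) \<le> exp (- (k * s\<^sup>2))" by simp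
  then have "s * exp (- c * (x / y) powr (2 / \<alpha>)) \<le> s * exp (- (k * s\<^sup>2))"
    using s by simp
  also have "\<dots> \<le> 1 + 1 / k"
  proof -
    have "s \<le> 1 + s\<^sup>2" using sum_squares_bound[of s 1] s by simp
    also have "\<dots> \<le> (1 + 1 / k) * (1 + k * s\<^sup>2)" using k s by (simp add: field_simps)
    also have "\<dots> \<le> (1 + 1 / k) * exp (k * s\<^sup>2)"
      using k by (intro mult_left_mono exp_ge_add_one_self) auto
    finally show ?thesis by (simp add: exp_minus field_simps)
  qed
  finally show ?thesis by (simp add: s_def k_def)
qed

context
  fixes \<alpha> c :: real
  assumes \<alpha>: "0 < \<alpha>" "\<alpha> < 1" and c: "0 < c"
begin

lemma set_integrable_scale_mixture_pos:
  assumes \<phi>: "integrable lborel \<phi>" and x: "x > 0"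
  shows "set_integrable lborel {0<..} (\<lambda>w. exp (- c * w\<^sup>2) * (\<phi> (x / w powr \<alpha>) / w powr \<alpha>))"
proof -
  have [measurable]: "\<phi> \<in> borel_measurable borel" using \<phi> by auto
  define B where "B = 1 + 1 / (c * x powr (2 / \<alpha>))"
  have "set_integrable lborel {0<..} (\<lambda>y. y powr (- 1 / \<alpha>) * exp (- c * (x / y) powr (2 / \<alpha>)) * \<phi> y)"
    unfolding set_integrable_def
  proof (rule Bochner_Integration.integrable_bound)
    show "integrable lborel (\<lambda>y. B * \<phi> y)" using \<phi> by simp
    show "AE y in lborel. norm (indicator {0<..} y *\<^sub>R (y powr (- 1 / \<alpha>) *
        exp (- c * (x / y) powr (2 / \<alpha>)) * \<phi> y)) \<le> norm (B * \<phi> y)"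
    proof (intro AE_I2)
      fix y :: real
      show "norm (indicator {0<..} y *\<^sub>R (y powr (- 1 / \<alpha>) *
        exp (- c * (x / y) powr (2 / \<alpha>)) * \<phi> y)) \<le> norm (B * \<phi> y)"
        using kernel_bound[of c \<alpha> x x y] c \<alpha> x
        by (auto simp: indicator_def abs_mult B_def intro!: mult_right_mono)
    qed
  qed measurable
  then show ?thesis
    by (subst set_integrable_scale_mixture_kernel) (use \<alpha> x in auto)
qed

text \<open>
  At \<open>x = 0\<close> the integrand is a multiple of \<open>exp (- c * w\<^sup>2) * w powr (- \<alpha>)\<close>, which is integrable since
  \<open>\<alpha> < 1\<close>.
\<close>

lemma set_integrable_scale_mixture:
  assumes \<phi>: "integrable lborel \<phi>"
  shows "set_integrable lborel {0<..} (\<lambda>w. exp (- c * w\<^sup>2) * (\<phi> (x / w powr \<alpha>) / w powr \<alpha>))"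
proof -
  consider "x > 0" | "x = 0" | "x < 0" by linarith
  then show ?thesis
  proof cases
    case 1 then show ?thesis by (rule set_integrable_scale_mixture_pos[OF \<phi>])
  next
    case 2
    have "set_integrable lborel {0<..} (\<lambda>w. \<phi> 0 * (exp (- c * w\<^sup>2) * w powr (- \<alpha>)))"
      using gaussian_moment(1)[OF c, of "- \<alpha>"] \<alpha> by (intro set_integrable_mult_right) simp
    then show ?thesis using 2 by (simp add: powr_minus field_simps)
  next
    case 3
    have "integrable lborel (\<lambda>y. \<phi> (- y))"
      using lborel_integrable_real_affine[OF \<phi>, of "-1" 0] by simp
    from set_integrable_scale_mixture_pos[OF this, of "- x"] 3 show ?thesis by simp
  qed
qed

text \<open>
  Dominated convergence in the kernel form; \<open>kernel_bound\<close> provides a majorant that is the same for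
  all \<open>x \<ge> d\<close>.
\<close>

lemma continuous_on_scale_mixture_pos:
  assumes \<phi>: "integrable lborel \<phi>" and d: "d > 0"
  shows "continuous_on {d..} (scale_mixture \<alpha> c \<phi>)"
proof -
  have [measurable]: "\<phi> \<in> borel_measurable borel" using \<phi> by auto
  define B where "B = 1 + 1 / (c * d powr (2 / \<alpha>))"
  define K where "K x y = indicator {0<..} y *\<^sub>R (y powr (- 1 / \<alpha>) * exp (- c * (x / y) powr (2 / \<alpha>)) * \<phi> y)"
    for x y
  have "continuous_on {d..} (\<lambda>x. LINT y|lborel. K x y)"
    unfolding continuous_on_sequentially
  proof (intro ballI allI impI)
    fix X :: "nat \<Rightarrow> real" and a
    assume a: "a \<in> {d..}" and X: "(\<forall>n. X n \<in> {d..}) \<and> X \<longlonglongrightarrow> a"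
    have "(\<lambda>n. LINT y|lborel. K (X n) y) \<longlonglongrightarrow> (LINT y|lborel. K a y)"
    proof (rule integral_dominated_convergence)
      show "integrable lborel (\<lambda>y. B * \<bar>\<phi> y\<bar>)" using \<phi> by simp
      show "AE y in lborel. norm (K (X n) y) \<le> B * \<bar>\<phi> y\<bar>" for n
      proof (intro AE_I2)
        fix y
        show "norm (K (X n) y) \<le> B * \<bar>\<phi> y\<bar>"
          using kernel_bound[of c \<alpha> d "X n" y] c \<alpha> d X
          by (cases "y > 0") (auto simp: K_def abs_mult B_def intro!: mult_right_mono add_nonneg_nonneg)
      qed
      show "AE y in lborel. (\<lambda>n. K (X n) y) \<longlonglongrightarrow> K a y"
      proof (intro AE_I2)
        fix y
        show "(\<lambda>n. K (X n) y) \<longlonglongrightarrow> K a y"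
        proof (cases "y > 0")
          case True
          have lim: "(\<lambda>n. X n / y) \<longlonglongrightarrow> a / y" using X True by (intro tendsto_intros) auto
          have "(\<lambda>n. (X n / y) powr (2 / \<alpha>)) \<longlonglongrightarrow> (a / y) powr (2 / \<alpha>)"
            by (rule tendsto_powr[OF lim tendsto_const]) (use a d True in auto)
          then show ?thesis
            unfolding K_def by (intro tendsto_scaleR tendsto_mult tendsto_exp tendsto_const)
        qed (simp add: K_def)
      qed
    qed (simp_all add: K_def)
    then show "((\<lambda>x. LINT y|lborel. K x y) \<circ> X) \<longlonglongrightarrow> (LINT y|lborel. K a y)"
      by (simp add: o_def)
  qed
  then have "continuous_on {d..} (\<lambda>x. x powr (1 / \<alpha> - 1) / \<alpha> * (LINT y|lborel. K x y))"
    using \<alpha> d by (intro continuous_intros) auto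
  then show ?thesis
    by (rule continuous_on_eq)
      (use d \<alpha> in \<open>auto simp: scale_mixture_eq_kernel K_def set_lebesgue_integral_def\<close>)
qed

text \<open>
  The kernel form degenerates at \<open>x = 0\<close>, and the original form offers no majorant for small \<open>w\<close>,
  as \<open>\<phi>\<close> may be unbounded. So \<open>\<phi>\<close> is cut at \<open>1\<close>: the part on \<open>y \<le> 1\<close> only sees values of
  \<open>\<phi>\<close> on the compact interval \<open>{0..1}\<close> and converges by dominated convergence in the original form. The part
  on \<open>y > 1\<close>, where the kernel is at most \<open>1\<close>, is at most \<open>x powr (1 / \<alpha> - 1) / \<alpha>\<close> times the
  \<open>L\<^sup>1\<close> norm of \<open>\<phi>\<close>.
\<close>

lemma scale_mixture_tendsto_0:
  assumes \<phi>: "integrable lborel \<phi>" and cont: "continuous_on UNIV \<phi>"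
  shows "(scale_mixture \<alpha> c \<phi> \<longlongrightarrow> scale_mixture \<alpha> c \<phi> 0) (at_right 0)"
proof -
  have [measurable]: "\<phi> \<in> borel_measurable borel" using \<phi> by auto
  define \<phi>1 where "\<phi>1 = (\<lambda>y. indicator {..1} y * \<phi> y)"
  define \<phi>2 where "\<phi>2 = (\<lambda>y. indicator {1<..} y * \<phi> y)"
  have i1: "integrable lborel \<phi>1" and i2: "integrable lborel \<phi>2"
    using integrable_mult_indicator[OF _ \<phi>, of "{..1}"] integrable_mult_indicator[OF _ \<phi>, of "{1<..}"]
    by (auto simp: \<phi>1_def \<phi>2_def)
  have [measurable]: "\<phi>1 \<in> borel_measurable borel" "\<phi>2 \<in> borel_measurable borel"
    unfolding \<phi>1_def \<phi>2_def by measurable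
  have split: "scale_mixture \<alpha> c \<phi> x = scale_mixture \<alpha> c \<phi>1 x + scale_mixture \<alpha> c \<phi>2 x" for x
  proof -
    have "\<phi> = (\<lambda>y. \<phi>1 y + \<phi>2 y)" by (auto simp: \<phi>1_def \<phi>2_def indicator_def fun_eq_iff)
    then show ?thesis
      using set_integral_add(2)[OF set_integrable_scale_mixture[OF i1, of x] set_integrable_scale_mixture[OF i2, of x]]
      by (simp add: scale_mixture_def add_divide_distrib distrib_left)
  qed
  have "bounded (\<phi> ` {0..1})"
    by (intro compact_imp_bounded compact_continuous_image continuous_on_subset[OF cont]) auto
  then obtain B where "\<forall>y\<in>\<phi> ` {0..1}. norm y \<le> B"
    unfolding bounded_iff by blast
  then have B: "\<bar>\<phi> y\<bar> \<le> B" if "0 \<le> y" "y \<le> 1" for y using that by auto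
  have "B \<ge> 0" using B[of 0] by simp
  have near: "(scale_mixture \<alpha> c \<phi>1 \<longlongrightarrow> scale_mixture \<alpha> c \<phi>1 0) (at_right 0)"
    unfolding tendsto_at_iff_sequentially
  proof (intro allI impI)
    fix X :: "nat \<Rightarrow> real"
    assume X: "\<forall>i. X i \<in> {0<..} - {0}" "X \<longlonglongrightarrow> 0"
    have "(\<lambda>n. scale_mixture \<alpha> c \<phi>1 (X n)) \<longlonglongrightarrow> scale_mixture \<alpha> c \<phi>1 0"
      unfolding scale_mixture_def set_lebesgue_integral_def
    proof (rule integral_dominated_convergence)
      show "integrable lborel (\<lambda>w. B * (indicator {0<..} w *\<^sub>R (exp (- c * w\<^sup>2) * w powr (- \<alpha>))))"
        using gaussian_moment(1)[OF c, of "- \<alpha>"] \<alpha>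
        unfolding set_integrable_def by (intro integrable_mult_right) simp
      show "AE w in lborel. norm (indicator {0<..} w *\<^sub>R (exp (- c * w\<^sup>2) * (\<phi>1 (X n / w powr \<alpha>) / w powr \<alpha>)))
          \<le> B * (indicator {0<..} w *\<^sub>R (exp (- c * w\<^sup>2) * w powr (- \<alpha>)))" for n
      proof (intro AE_I2)
        fix w :: real
        have "\<bar>\<phi>1 (X n / w powr \<alpha>)\<bar> \<le> B"
          using X(1)[rule_format, of n] B[of "X n / w powr \<alpha>"] \<open>B \<ge> 0\<close>
          by (auto simp: \<phi>1_def indicator_def simp del: divide_le_eq_1)
        then have "exp (- c * w\<^sup>2) * w powr (- \<alpha>) * \<bar>\<phi>1 (X n / w powr \<alpha>)\<bar> \<le> exp (- c * w\<^sup>2) * w powr (- \<alpha>) * B"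
          by (intro mult_left_mono) auto
        then show "norm (indicator {0<..} w *\<^sub>R (exp (- c * w\<^sup>2) * (\<phi>1 (X n / w powr \<alpha>) / w powr \<alpha>)))
          \<le> B * (indicator {0<..} w *\<^sub>R (exp (- c * w\<^sup>2) * w powr (- \<alpha>)))"
          by (auto simp: indicator_def abs_mult powr_minus divide_inverse mult_ac)
      qed
      show "AE w in lborel. (\<lambda>n. indicator {0<..} w *\<^sub>R (exp (- c * w\<^sup>2) * (\<phi>1 (X n / w powr \<alpha>) / w powr \<alpha>)))
          \<longlonglongrightarrow> indicator {0<..} w *\<^sub>R (exp (- c * w\<^sup>2) * (\<phi>1 (0 / w powr \<alpha>) / w powr \<alpha>))"
      proof (intro AE_I2)
        fix w :: real
        show "(\<lambda>n. indicator {0<..} w *\<^sub>R (exp (- c * w\<^sup>2) * (\<phi>1 (X n / w powr \<alpha>) / w powr \<alpha>)))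
          \<longlonglongrightarrow> indicator {0<..} w *\<^sub>R (exp (- c * w\<^sup>2) * (\<phi>1 (0 / w powr \<alpha>) / w powr \<alpha>))"
        proof (cases "w > 0")
          case True
          have "(\<lambda>n. X n / w powr \<alpha>) \<longlonglongrightarrow> 0 / w powr \<alpha>" using X True by (intro tendsto_intros) auto
          moreover have "isCont \<phi>1 0"
          proof -
            have "isCont \<phi> 0" using cont by (simp add: continuous_on_eq_continuous_at)
            moreover have "\<forall>\<^sub>F y in nhds 0. \<phi>1 y = \<phi> y"
            proof -
              have "\<forall>\<^sub>F y in nhds (0::real). y < 1" by (rule order_tendstoD) (auto intro: filterlim_ident)
              then show ?thesis by eventually_elim (simp add: \<phi>1_def)
            qed
            ultimately show ?thesis using isCont_cong by blast
          qed
          ultimately have "(\<lambda>n. \<phi>1 (X n / w powr \<alpha>)) \<longlonglongrightarrow> \<phi>1 (0 / w powr \<alpha>)"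
            by (intro isCont_tendsto_compose[of _ \<phi>1]) auto
          then show ?thesis using True by (intro tendsto_intros) auto
        qed simp
      qed
    qed measurable
    then show "(scale_mixture \<alpha> c \<phi>1 \<circ> X) \<longlonglongrightarrow> scale_mixture \<alpha> c \<phi>1 0"
      by (simp add: o_def)
  qed
  have far: "(scale_mixture \<alpha> c \<phi>2 \<longlongrightarrow> 0) (at_right 0)"
  proof (rule Lim_null_comparison)
    define I where "I = (LINT y|lborel. \<bar>\<phi>2 y\<bar>)"
    show "\<forall>\<^sub>F x in at_right 0. norm (scale_mixture \<alpha> c \<phi>2 x) \<le> x powr (1 / \<alpha> - 1) / \<alpha> * I"
    proof (rule eventually_at_right_less[THEN eventually_mono])
      fix x :: real assume x: "0 < x"
      have "norm (LINT y:{0<..}|lborel. y powr (- 1 / \<alpha>) * exp (- c * (x / y) powr (2 / \<alpha>)) * \<phi>2 y) \<le> I"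
        unfolding I_def set_lebesgue_integral_def
      proof (rule order.trans[OF integral_norm_bound Bochner_Integration.integral_mono])
        show "integrable lborel (\<lambda>y. norm (indicator {0<..} y *\<^sub>R (y powr (- 1 / \<alpha>) * exp (- c * (x / y) powr (2 / \<alpha>)) * \<phi>2 y)))"
          by (rule integrable_norm) (use set_integrable_scale_mixture[OF i2, of x] set_integrable_scale_mixture_kernel[of \<phi>2 \<alpha> x c] \<alpha> x
            in \<open>simp add: set_integrable_def\<close>)
        show "integrable lborel (\<lambda>y. \<bar>\<phi>2 y\<bar>)" using i2 by simp
        fix y :: real
        show "norm (indicator {0<..} y *\<^sub>R (y powr (- 1 / \<alpha>) * exp (- c * (x / y) powr (2 / \<alpha>)) * \<phi>2 y)) \<le> \<bar>\<phi>2 y\<bar>"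
        proof (cases "y > 1")
          case True
          have "y powr (- 1 / \<alpha>) * exp (- c * (x / y) powr (2 / \<alpha>)) \<le> 1 * 1"
          proof (rule mult_mono)
            have "y powr (- 1 / \<alpha>) \<le> y powr 0" using True \<alpha> by (intro powr_mono) auto
            then show "y powr (- 1 / \<alpha>) \<le> 1" using True by simp
          qed (use c in auto)
          then have "y powr (- 1 / \<alpha>) * exp (- c * (x / y) powr (2 / \<alpha>)) * \<bar>\<phi>2 y\<bar> \<le> 1 * \<bar>\<phi>2 y\<bar>"
            by (intro mult_right_mono) auto
          then show ?thesis using True by (simp add: abs_mult)
        qed (simp add: \<phi>2_def)
      qed
      then have "x powr (1 / \<alpha> - 1) / \<alpha> * norm (LINT y:{0<..}|lborel. y powr (- 1 / \<alpha>) * exp (- c * (x / y) powr (2 / \<alpha>)) * \<phi>2 y) \<le> x powr (1 / \<alpha> - 1) / \<alpha> * I"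
        using \<alpha> by (intro mult_left_mono) auto
      then show "norm (scale_mixture \<alpha> c \<phi>2 x) \<le> x powr (1 / \<alpha> - 1) / \<alpha> * I"
        using \<alpha> x by (simp add: scale_mixture_eq_kernel abs_mult)
    qed
    have "((\<lambda>x. x powr (1 / \<alpha> - 1) / \<alpha> * I) \<longlongrightarrow> 0 powr (1 / \<alpha> - 1) / \<alpha> * I) (at_right 0)"
    proof -
      have "((\<lambda>x::real. x powr (1 / \<alpha> - 1)) \<longlongrightarrow> 0 powr (1 / \<alpha> - 1)) (at_right 0)"
        by (rule tendsto_powr') (use \<alpha> in \<open>auto simp: eventually_at_filter\<close>)
      then show ?thesis using \<alpha> by (intro tendsto_mult tendsto_divide tendsto_const) auto
    qed
    then show "((\<lambda>x. x powr (1 / \<alpha> - 1) / \<alpha> * I) \<longlongrightarrow> 0) (at_right 0)" by simp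
  qed
  have "scale_mixture \<alpha> c \<phi>2 0 = 0" by (simp add: scale_mixture_def \<phi>2_def)
  moreover have "scale_mixture \<alpha> c \<phi> = (\<lambda>x. scale_mixture \<alpha> c \<phi>1 x + scale_mixture \<alpha> c \<phi>2 x)"
    using split by (rule ext)
  ultimately show ?thesis using tendsto_add[OF near far] by simp
qed

lemma continuous_on_scale_mixture:
  assumes \<phi>: "integrable lborel \<phi>" and cont: "continuous_on UNIV \<phi>"
  shows "continuous_on UNIV (scale_mixture \<alpha> c \<phi>)"
proof -
  have \<phi>': "integrable lborel (\<lambda>y. \<phi> (- y))" "continuous_on UNIV (\<lambda>y. \<phi> (- y))"
    using lborel_integrable_real_affine[OF \<phi>, of "-1" 0]
    by (auto intro!: continuous_on_compose2[OF cont] continuous_intros)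
  have pos: "isCont (scale_mixture \<alpha> c \<psi>) x" if "integrable lborel \<psi>" "x > 0" for \<psi> x
  proof -
    have "continuous_on {x / 2..} (scale_mixture \<alpha> c \<psi>)"
      using that by (intro continuous_on_scale_mixture_pos) auto
    then show ?thesis
      by (rule continuous_on_interior) (use that in simp)
  qed
  have refl: "scale_mixture \<alpha> c \<phi> = (\<lambda>x. scale_mixture \<alpha> c (\<lambda>y. \<phi> (- y)) (- x))"
    by (simp add: scale_mixture_uminus)
  have "isCont (scale_mixture \<alpha> c \<phi>) x" for x
  proof -
    consider "x > 0" | "x = 0" | "x < 0" by linarith
    then show ?thesis
    proof cases
      case 1 then show ?thesis by (rule pos[OF \<phi>])
    next
      case 2
      have "scale_mixture \<alpha> c (\<lambda>y. \<phi> (- y)) 0 = scale_mixture \<alpha> c \<phi> 0"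
        by (simp add: scale_mixture_def)
      then have "(scale_mixture \<alpha> c \<phi> \<longlongrightarrow> scale_mixture \<alpha> c \<phi> 0) (at_left 0)"
        using scale_mixture_tendsto_0[OF \<phi>'] unfolding filterlim_at_left_to_right
        by (simp add: scale_mixture_uminus)
      with scale_mixture_tendsto_0[OF \<phi> cont] show ?thesis
        unfolding isCont_def 2 by (rule filterlim_split_at_real[rotated])
    next
      case 3
      have "isCont (\<lambda>x. scale_mixture \<alpha> c (\<lambda>y. \<phi> (- y)) (- x)) x"
        by (rule isCont_o2[OF _ pos]) (use 3 \<phi>' in auto)
      then show ?thesis unfolding refl[symmetric] .
    qed
  qed
  then show ?thesis by (simp add: continuous_on_eq_continuous_at)
qed

end

section \<open>Gaussian averages of Mittag-Leffler functions\<close>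

text \<open>
  On \<open>{M..}\<close> the factor \<open>t powr s\<close> of the Gamma integrand is at least \<open>M powr s\<close>.
\<close>

lemma Gamma_lower_bound:
  fixes M s :: real
  assumes M: "M \<ge> 0" and s: "s \<ge> 0"
  shows "M powr s * exp (- M) \<le> Gamma (s + 1)"
proof -
  have "((\<lambda>t. M powr s * exp (- 1 * t)) has_integral M powr s * (exp (- 1 * M) / 1)) {M..}"
    by (intro has_integral_mult_right has_integral_exp_minus_to_infinity) simp
  then have i1: "((\<lambda>t. if t \<in> {M..} then M powr s * exp (- 1 * t) else 0)
      has_integral M powr s * exp (- M)) {0..}"
    using M by (subst has_integral_restrict) auto
  have i2: "((\<lambda>t. t powr (s + 1 - 1) / exp t) has_integral Gamma (s + 1)) {0..}"
    using s by (intro Gamma_integral_real) simp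
  show ?thesis
    by (rule has_integral_le[OF i1 i2]) (use M s in \<open>auto simp: exp_minus field_simps intro!: powr_mono2\<close>)
qed

text \<open>
  By \<open>Gamma_lower_bound\<close>, \<open>Gamma (\<theta> * k + 1)\<close> grows at least like \<open>(M powr \<theta>) ^ k\<close> for every \<open>M\<close>.
  Choosing \<open>M\<close> with \<open>M powr \<theta> > 2 * \<bar>x\<bar>\<close> gives a geometric majorant of ratio \<open>1 / 2\<close>.
\<close>

lemma summable_mittag_leffler:
  fixes \<theta> x :: real
  assumes th: "\<theta> > 0"
  shows "summable (\<lambda>k. x ^ k / Gamma (\<theta> * real k + 1))"
proof -
  define R where "R = 2 * \<bar>x\<bar> + 1"
  define M where "M = R powr (1 / \<theta>)"
  have R: "R > 0" by (simp add: R_def)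
  have MR: "M powr (\<theta> * real k) = R ^ k" for k
    using R th by (simp add: M_def powr_powr powr_realpow)
  show ?thesis
  proof (rule summable_comparison_test')
    show "summable (\<lambda>k. exp M * (1 / 2) ^ k)"
      by (intro summable_mult summable_geometric) simp
  next
    fix k :: nat assume "k \<ge> 0"
    have "R ^ k * exp (- M) \<le> Gamma (\<theta> * real k + 1)"
      using Gamma_lower_bound[of M "\<theta> * real k"] th by (simp add: MR) (simp add: M_def)
    moreover have "R ^ k * exp (- M) > 0" using R by simp
    ultimately have "norm (x ^ k / Gamma (\<theta> * real k + 1)) \<le> \<bar>x\<bar> ^ k / (R ^ k * exp (- M))"
      by (auto simp: power_abs intro!: frac_le)
    also have "\<dots> = exp M * (\<bar>x\<bar> / R) ^ k"
      by (simp add: exp_minus power_divide field_simps)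
    also have "\<dots> \<le> exp M * (1 / 2) ^ k"
      by (intro mult_left_mono power_mono) (auto simp: R_def field_simps)
    finally show "norm (x ^ k / Gamma (\<theta> * real k + 1)) \<le> exp M * (1 / 2) ^ k" .
  qed
qed

lemma legendre_duplication_real:
  fixes x :: real
  assumes "x > 0"
  shows "Gamma x * Gamma (x + 1/2) = 2 powr (1 - 2 * x) * sqrt pi * Gamma (2 * x)"
proof -
  have "complex_of_real x \<notin> \<int>\<^sub>\<le>\<^sub>0" "complex_of_real (x + 1/2) \<notin> \<int>\<^sub>\<le>\<^sub>0"
    using assms by (auto simp only: of_real_in_nonpos_Ints_iff elim!: nonpos_Ints_cases)
  then have "complex_of_real (Gamma x * Gamma (x + 1/2)) = complex_of_real (2 powr (1 - 2 * x) * sqrt pi * Gamma (2 * x))"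
    using Gamma_legendre_duplication[of "complex_of_real x"]
    by (simp add: powr_def flip: exp_of_real Gamma_complex_of_real)
  then show ?thesis by (simp only: of_real_eq_iff)
qed

text \<open>
  The moment of order \<open>2 * \<alpha> * k\<close> contributes \<open>Gamma (\<alpha> * k + 1 / 2)\<close>. By the duplication formula this
  cancels the denominator \<open>Gamma (2 * \<alpha> * k + 1)\<close> up to \<open>sqrt pi\<close> and a power of \<open>2\<close>, and leaves
  \<open>Gamma (\<alpha> * k + 1)\<close> in its place.
\<close>

lemma mittag_leffler_moment:
  fixes \<alpha> c b :: real
  assumes \<alpha>: "\<alpha> > 0" and c: "c > 0"
  shows "set_integrable lborel {0<..}
      (\<lambda>w. exp (- c * w\<^sup>2) * ((b * w powr (2 * \<alpha>)) ^ k / Gamma (2 * \<alpha> * real k + 1)))"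
    and "(LINT w:{0<..}|lborel.
        exp (- c * w\<^sup>2) * ((b * w powr (2 * \<alpha>)) ^ k / Gamma (2 * \<alpha> * real k + 1))) =
      sqrt (pi / c) / 2 * ((b * (4 * c) powr (- \<alpha>)) ^ k / Gamma (\<alpha> * real k + 1))"
proof -
  define a where "a = \<alpha> * real k"
  have a: "a \<ge> 0" using \<alpha> by (simp add: a_def)
  define G where "G = Gamma (2 * a + 1)"
  have Gpos: "G > 0" "Gamma (a + 1) > 0" using a by (simp_all add: G_def Gamma_real_pos)
  have eq: "exp (- c * w\<^sup>2) * ((b * w powr (2 * \<alpha>)) ^ k / Gamma (2 * \<alpha> * real k + 1)) =
      b ^ k / G * (exp (- c * w\<^sup>2) * w powr (2 * a))" if "w \<in> {0<..}" for w
    using that by (simp add: power_mult_distrib powr_power G_def a_def mult_ac)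
  note m = gaussian_moment[OF c, of "2 * a"]
  have "set_integrable lborel {0<..} (\<lambda>w. b ^ k / G * (exp (- c * w\<^sup>2) * w powr (2 * a)))"
    using m(1) a by (intro set_integrable_mult_right) simp
  then show "set_integrable lborel {0<..}
      (\<lambda>w. exp (- c * w\<^sup>2) * ((b * w powr (2 * \<alpha>)) ^ k / Gamma (2 * \<alpha> * real k + 1)))"
    by (rule iffD2[OF set_integrable_cong[OF refl refl eq], rotated -1]) simp_all
  have "(LINT w:{0<..}|lborel.
        exp (- c * w\<^sup>2) * ((b * w powr (2 * \<alpha>)) ^ k / Gamma (2 * \<alpha> * real k + 1))) =
      (LINT w:{0<..}|lborel. b ^ k / G * (exp (- c * w\<^sup>2) * w powr (2 * a)))"
    by (rule set_lebesgue_integral_cong) (use eq in auto)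
  also have "\<dots> = b ^ k / G * (Gamma (a + 1 / 2) / (2 * c powr (a + 1 / 2)))"
    using m(2) a by (subst set_integral_mult_right) (simp add: add_divide_distrib)
  also have "Gamma (a + 1 / 2) = 2 powr (- 2 * a) * sqrt pi * G / Gamma (a + 1)"
  proof -
    have "a + 1 / 2 + 1 / 2 = a + 1" "2 * (a + 1 / 2) = 2 * a + 1" "1 - (2 * a + 1) = - 2 * a"
      by simp_all
    then have "Gamma (a + 1 / 2) * Gamma (a + 1) = 2 powr (- 2 * a) * sqrt pi * G"
      using legendre_duplication_real[of "a + 1 / 2"] a by (simp only: G_def)
    then show ?thesis using Gpos(2) by (simp only: eq_divide_eq) simp
  qed
  also have "c powr (a + 1 / 2) = c powr a * sqrt c"
    using c by (simp add: powr_add powr_half_sqrt)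
  also have "b ^ k / G * (2 powr (- 2 * a) * sqrt pi * G / Gamma (a + 1) / (2 * (c powr a * sqrt c))) =
      sqrt (pi / c) / 2 * (b ^ k * (2 powr (- 2 * a) / c powr a) / Gamma (a + 1))"
    using Gpos c by (simp add: real_sqrt_divide field_simps)
  also have "2 powr (- 2 * a) / c powr a = ((4 * c) powr (- \<alpha>)) ^ k"
  proof -
    have "2 powr (- 2 * a) = (2 powr 2) powr (- a)" by (simp only: powr_powr) simp
    then have "2 powr (- 2 * a) / c powr a = (4 * c) powr (- a)"
      using c by (simp add: powr_mult powr_minus field_simps)
    also have "\<dots> = ((4 * c) powr (- \<alpha>)) ^ k"
      using c by (simp add: powr_power a_def mult_ac)
    finally show ?thesis .
  qed
  finally show "(LINT w:{0<..}|lborel.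
        exp (- c * w\<^sup>2) * ((b * w powr (2 * \<alpha>)) ^ k / Gamma (2 * \<alpha> * real k + 1))) =
      sqrt (pi / c) / 2 * ((b * (4 * c) powr (- \<alpha>)) ^ k / Gamma (\<alpha> * real k + 1))"
    by (simp add: power_mult_distrib a_def)
qed

text \<open>
  Termwise integration of the series. It is justified because the integrals of the absolute values of the
  terms are, up to a constant factor, the terms of the Mittag-Leffler series of order \<open>\<alpha>\<close> with \<open>b\<close> replaced by \<open>\<bar>b\<bar>\<close>.
\<close>

lemma mittag_leffler_subordination:
  fixes \<alpha> c b :: real
  assumes \<alpha>: "\<alpha> > 0" and c: "c > 0"
  shows "(LINT w:{0<..}|lborel. exp (- c * w\<^sup>2) * mittag_leffler (2 * \<alpha>) (b * w powr (2 * \<alpha>))) =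
    sqrt (pi / c) / 2 * mittag_leffler \<alpha> (b * (4 * c) powr (- \<alpha>))"
proof -
  define F where "F b k w = indicator {0<..} w *\<^sub>R
      (exp (- c * w\<^sup>2) * ((b * w powr (2 * \<alpha>)) ^ k / Gamma (2 * \<alpha> * real k + 1)))" for b :: real and k w
  have Fi: "integrable lborel (F b k)" for b k
    using mittag_leffler_moment(1)[OF \<alpha> c] by (simp add: F_def[abs_def] set_integrable_def)
  have FI: "integral\<^sup>L lborel (F b k) =
      sqrt (pi / c) / 2 * ((b * (4 * c) powr (- \<alpha>)) ^ k / Gamma (\<alpha> * real k + 1))" for b k
    using mittag_leffler_moment(2)[OF \<alpha> c] by (simp add: F_def[abs_def] set_lebesgue_integral_def)
  have Fn: "norm (F b k w) = F \<bar>b\<bar> k w" for b k w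
  proof -
    have "Gamma (2 * \<alpha> * real k + 1) > 0" using \<alpha> by (intro Gamma_real_pos add_nonneg_pos) auto
    then show ?thesis by (simp add: F_def abs_mult power_abs indicator_def)
  qed
  have sm: "summable (\<lambda>k. F b k w)" for b w
    using summable_mult[OF summable_mittag_leffler[of "2 * \<alpha>" "b * w powr (2 * \<alpha>)"],
        of "exp (- c * w\<^sup>2)"] \<alpha>
    by (cases "w > 0") (simp_all add: F_def)
  have "(\<lambda>k. integral\<^sup>L lborel (F b k)) sums (LINT w|lborel. (\<Sum>k. F b k w))"
  proof (rule sums_integral)
    show "summable (\<lambda>k. LINT w|lborel. norm (F b k w))"
      unfolding Fn FI using summable_mittag_leffler[OF \<alpha>] by (rule summable_mult)
    show "AE w in lborel. summable (\<lambda>k. norm (F b k w))"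
      unfolding Fn by (intro AE_I2 sm)
  qed (rule Fi)
  then have "(LINT w|lborel. (\<Sum>k. F b k w)) = (\<Sum>k. integral\<^sup>L lborel (F b k))"
    by (simp add: sums_iff)
  also have "\<dots> = sqrt (pi / c) / 2 * mittag_leffler \<alpha> (b * (4 * c) powr (- \<alpha>))"
    unfolding FI mittag_leffler_def by (rule suminf_mult[OF summable_mittag_leffler[OF \<alpha>]])
  also have "(LINT w|lborel. (\<Sum>k. F b k w)) =
      (LINT w:{0<..}|lborel. exp (- c * w\<^sup>2) * mittag_leffler (2 * \<alpha>) (b * w powr (2 * \<alpha>)))"
    unfolding set_lebesgue_integral_def
  proof (intro Bochner_Integration.integral_cong refl)
    fix w :: real
    have "summable (\<lambda>k. (b * w powr (2 * \<alpha>)) ^ k / Gamma (2 * \<alpha> * real k + 1))"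
      using \<alpha> by (intro summable_mittag_leffler) simp
    from suminf_mult[OF this, of "exp (- c * w\<^sup>2)"]
    show "(\<Sum>k. F b k w) = indicator {0<..} w *\<^sub>R
        (exp (- c * w\<^sup>2) * mittag_leffler (2 * \<alpha>) (b * w powr (2 * \<alpha>)))"
      by (cases "w > 0") (simp_all add: F_def mittag_leffler_def)
  qed
  finally show ?thesis .
qed


section \<open>Subordination of the solutions\<close>

lemma is_the_solutionD:
  assumes "is_the_solution H \<theta> u" "t > 0"
  shows "continuous_on UNIV (\<lambda>x. u x t)" "integrable lborel (\<lambda>x. u x t)"
    "fourier (\<lambda>x. u x t) \<beta> =
      complex_of_real (mittag_leffler \<theta> (- (\<beta>\<^sup>2 * t powr (2 * H * \<theta>) / 2 powr \<theta>)))"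
  using assms by (auto simp: is_the_solution_def fourier_def)

text \<open>
  The transform depends on \<open>\<beta>\<close> and \<open>t\<close> only through the product \<open>\<beta> * t powr (H * \<theta>)\<close>, so the functions at
  different times are dilates of each other. Among other things this makes \<open>u\<close> jointly measurable in
  \<open>x\<close> and \<open>t\<close>.
\<close>

lemma is_the_solution_self_similar:
  assumes u: "is_the_solution H \<theta> u" and t: "t > 0"
  shows "u x t = u (x / t powr (H * \<theta>)) 1 / t powr (H * \<theta>)"
proof -
  define p where "p = t powr (H * \<theta>)"
  have p: "p > 0" using t by (simp add: p_def)
  have p2: "t powr (2 * H * \<theta>) = p\<^sup>2"
    using t by (simp add: p_def power2_eq_square mult.assoc flip: powr_add)
  note sol1 = is_the_solutionD[OF u zero_less_one]
  have "(\<lambda>x. u x t) = (\<lambda>x. u (x / p) 1 / p)"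
  proof (rule fourier_unique)
    show "integrable lborel (\<lambda>x. u (x / p) 1 / p)"
      using lborel_integrable_real_affine[OF sol1(2), of "1 / p" 0] p by simp
    show "continuous_on UNIV (\<lambda>x. u (x / p) 1 / p)"
      using p by (intro continuous_intros continuous_on_compose2[OF sol1(1)]) auto
    show "fourier (\<lambda>x. u x t) \<beta> = fourier (\<lambda>x. u (x / p) 1 / p) \<beta>" for \<beta>
      using fourier_scale[OF p, of "\<lambda>x. u x 1" \<beta>]
      by (simp add: is_the_solutionD(3)[OF u t] sol1(3) p2 power_mult_distrib)
  qed (use is_the_solutionD[OF u t] in auto)
  then show ?thesis unfolding p_def by (rule fun_cong)
qed

text \<open>
  Both sides are continuous and integrable in \<open>x\<close>, so it suffices to compare transforms. The value of
  \<open>c\<close> makes \<open>(4 * c) powr (- \<alpha>)\<close> equal to \<open>2 powr \<alpha> * t powr (2 * H * \<alpha>)\<close>, which together with the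
  factor \<open>2 powr (2 * \<alpha>)\<close> below \<open>\<beta>\<^sup>2\<close> in the transform of order \<open>2 * \<alpha>\<close> gives the transform of order \<open>\<alpha>\<close>.
\<close>

lemma solution_eq_scale_mixture:
  assumes \<alpha>: "0 < \<alpha>" "\<alpha> < 1"
    and u: "is_the_solution H \<alpha> u" and v: "is_the_solution H (2 * \<alpha>) v" and t: "t > 0"
  shows "u x t = scale_mixture \<alpha> (1 / (8 * t powr (2 * H))) (\<lambda>x. v x 1) x / (sqrt (2 * pi) * t powr H)"
proof -
  define s where "s = t powr H"
  have s: "s > 0" using t by (simp add: s_def)
  have s2: "t powr (2 * H) = s\<^sup>2" using t by (simp add: s_def power2_eq_square flip: powr_add)
  define c where "c = 1 / (8 * s\<^sup>2)"
  have c: "c > 0" using s by (simp add: c_def)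
  note v1 = is_the_solutionD[OF v zero_less_one]
  let ?G = "scale_mixture \<alpha> c (\<lambda>x. v x 1)"
  define K where "K = sqrt (2 * pi) * s"
  have K: "K > 0" using s by (simp add: K_def)
  have K': "sqrt (pi / c) / 2 = K"
  proof -
    have "pi / c = (2 * s)\<^sup>2 * (2 * pi)" by (simp add: c_def power2_eq_square)
    then have "sqrt (pi / c) = \<bar>2 * s\<bar> * sqrt (2 * pi)" by (simp only: real_sqrt_mult real_sqrt_abs)
    then show ?thesis using s by (simp add: K_def)
  qed
  have "(\<lambda>x. u x t) = (\<lambda>x. ?G x / K)"
  proof (rule fourier_unique)
    show "integrable lborel (\<lambda>x. ?G x / K)"
      using integrable_scale_mixture[OF v1(2) c] by simp
    show "continuous_on UNIV (\<lambda>x. ?G x / K)"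
      using K by (intro continuous_intros continuous_on_scale_mixture \<alpha> c v1) auto
    fix \<beta>
    define b where "b = - (\<beta>\<^sup>2 / 2 powr (2 * \<alpha>))"
    have "fourier (\<lambda>x. ?G x / K) \<beta> = fourier ?G \<beta> / K"
      by (simp add: fourier_def)
    also have "fourier ?G \<beta> =
        (LINT w:{0<..}|lborel. complex_of_real (exp (- c * w\<^sup>2) * mittag_leffler (2 * \<alpha>) (b * w powr (2 * \<alpha>))))"
      unfolding fourier_scale_mixture[OF v1(2) c]
    proof (rule set_lebesgue_integral_cong, simp, intro allI impI)
      fix w :: real assume "w \<in> {0<..}"
      then have "(w powr \<alpha>)\<^sup>2 = w powr (2 * \<alpha>)"
        by (simp add: power2_eq_square flip: powr_add)
      then show "complex_of_real (exp (- c * w\<^sup>2)) * fourier (\<lambda>x. v x 1) (\<beta> * w powr \<alpha>) =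
          complex_of_real (exp (- c * w\<^sup>2) * mittag_leffler (2 * \<alpha>) (b * w powr (2 * \<alpha>)))"
        by (simp add: v1(3) b_def power_mult_distrib)
    qed
    also have "\<dots> = complex_of_real (K * mittag_leffler \<alpha> (b * (4 * c) powr (- \<alpha>)))"
      unfolding set_integral_complex_of_real mittag_leffler_subordination[OF \<alpha>(1) c] K' ..
    also have "b * (4 * c) powr (- \<alpha>) = - (\<beta>\<^sup>2 * t powr (2 * H * \<alpha>) / 2 powr \<alpha>)"
    proof -
      have "(4 * c) powr (- \<alpha>) = (2 * s\<^sup>2) powr \<alpha>"
        using s by (simp add: c_def powr_minus powr_divide powr_mult field_simps)
      also have "\<dots> = 2 powr \<alpha> * t powr (2 * H * \<alpha>)"
        using t by (simp add: powr_mult powr_powr flip: s2)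
      finally have "(4 * c) powr (- \<alpha>) = 2 powr \<alpha> * t powr (2 * H * \<alpha>)" .
      moreover have "2 powr (2 * \<alpha>) = 2 powr \<alpha> * (2::real) powr \<alpha>" by (simp flip: powr_add)
      ultimately show ?thesis by (simp add: b_def)
    qed
    finally show "fourier (\<lambda>x. u x t) \<beta> = fourier (\<lambda>x. ?G x / K) \<beta>"
      using K by (simp add: is_the_solutionD(3)[OF u t])
  qed (use is_the_solutionD[OF u t] in auto)
  from fun_cong[OF this, of x] show ?thesis by (simp add: s2 c_def K_def s_def)
qed

theorem theorem3p2:
  fixes H \<alpha> :: real
    and u\<^sub>\<alpha> u\<^sub>2\<^sub>\<alpha> :: "real \<Rightarrow> real \<Rightarrow> real"
  assumes "0 < H" "H < 1"
    and "0 < \<alpha>" "\<alpha> < 1"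
    and "is_the_solution H \<alpha> u\<^sub>\<alpha>"
    and "is_the_solution H (2 * \<alpha>) u\<^sub>2\<^sub>\<alpha>"
  shows "\<forall>x. \<forall>t>0.
    set_integrable lborel {0<..}
      (\<lambda>z. z powr (2 * H - 1) * exp (- (1 / 8) * (z / sqrt t) powr (4 * H)) * u\<^sub>2\<^sub>\<alpha> x z) \<and>
    u\<^sub>\<alpha> x t = H * sqrt 2 / (sqrt pi * t powr H) *
      (LINT z:{0<..}|lborel.
         z powr (2 * H - 1) * exp (- (1 / 8) * (z / sqrt t) powr (4 * H)) * u\<^sub>2\<^sub>\<alpha> x z)"
proof (intro allI impI)
  fix x t :: real assume t: "t > 0"
  define c where "c = 1 / (8 * t powr (2 * H))"
  have c: "c > 0" using t by (simp add: c_def)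
  note v1 = is_the_solutionD[OF assms(6) zero_less_one]
  define \<phi> where "\<phi> = (\<lambda>x. u\<^sub>2\<^sub>\<alpha> x 1)"
  have [measurable]: "\<phi> \<in> borel_measurable borel" using v1(2) unfolding \<phi>_def by auto
  define f where "f w = exp (- c * w\<^sup>2) * (\<phi> (x / w powr \<alpha>) / w powr \<alpha>)" for w
  \<comment> \<open>Under \<open>w = z powr (2 * H)\<close> the given integrand is \<open>g\<close> times the Jacobian; the division by
  \<open>2 * H\<close> compensates for the constant of the Jacobian.\<close>
  define g where "g = (\<lambda>w. f w / (2 * H))"
  have gm: "g \<in> borel_measurable borel" unfolding g_def f_def by measurable
  let ?h = "\<lambda>z. z powr (2 * H - 1) * exp (- (1 / 8) * (z / sqrt t) powr (4 * H)) * u\<^sub>2\<^sub>\<alpha> x z"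
  have eq: "1 * \<bar>2 * H\<bar> * z powr (2 * H - 1) * g (1 * z powr (2 * H)) = ?h z" if "z \<in> {0<..}" for z
  proof -
    have z: "z > 0" using that by simp
    have "(z / sqrt t) powr (4 * H) = ((z / sqrt t) powr 2) powr (2 * H)"
      by (simp only: powr_powr) simp
    also have "\<dots> = (z\<^sup>2 / t) powr (2 * H)" using z t by (simp add: power_divide)
    also have "\<dots> = (z powr (2 * H))\<^sup>2 / t powr (2 * H)"
      using z t by (simp add: powr_divide powr_powr mult_ac flip: powr_numeral)
    finally have 1: "- (1 / 8) * (z / sqrt t) powr (4 * H) = - c * (z powr (2 * H))\<^sup>2"
      by (simp add: c_def)
    have "(z powr (2 * H)) powr \<alpha> = z powr (H * (2 * \<alpha>))" by (simp add: powr_powr mult_ac)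
    then have 2: "u\<^sub>2\<^sub>\<alpha> x z = \<phi> (x / (z powr (2 * H)) powr \<alpha>) / (z powr (2 * H)) powr \<alpha>"
      using is_the_solution_self_similar[OF assms(6) z, of x] by (simp add: \<phi>_def)
    show ?thesis unfolding 1 2 g_def f_def using assms(1) by simp
  qed
  have "set_integrable lborel {0<..} g"
    unfolding g_def f_def using set_integrable_scale_mixture[OF assms(3,4) c v1(2)]
    by (intro set_integrable_divide) (simp add: \<phi>_def)
  then have "set_integrable lborel {0<..} (\<lambda>z. 1 * \<bar>2 * H\<bar> * z powr (2 * H - 1) * g (1 * z powr (2 * H)))"
    by (rule iffD2[OF set_integrable_power_substitution[OF gm zero_less_one], rotated]) (use assms(1) in simp)
  then have int: "set_integrable lborel {0<..} ?h"
    by (rule iffD1[OF set_integrable_cong[OF refl refl eq], rotated -1]) simp_all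
  have "(LINT z:{0<..}|lborel. ?h z) =
      (LINT z:{0<..}|lborel. 1 * \<bar>2 * H\<bar> * z powr (2 * H - 1) * g (1 * z powr (2 * H)))"
    by (rule set_lebesgue_integral_cong) (use eq in auto)
  also have "\<dots> = (LINT w:{0<..}|lborel. g w)"
    by (rule set_integral_power_substitution[OF gm zero_less_one]) (use assms(1) in simp)
  also have "\<dots> = scale_mixture \<alpha> c \<phi> x / (2 * H)"
    unfolding g_def f_def scale_mixture_def by (rule set_integral_divide_zero)
  finally have val: "(LINT z:{0<..}|lborel. ?h z) = scale_mixture \<alpha> c \<phi> x / (2 * H)" .
  have "u\<^sub>\<alpha> x t = scale_mixture \<alpha> c \<phi> x / (sqrt (2 * pi) * t powr H)"
    unfolding c_def \<phi>_def by (rule solution_eq_scale_mixture) (use assms t in auto)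
  also have "\<dots> = H * sqrt 2 / (sqrt pi * t powr H) * (scale_mixture \<alpha> c \<phi> x / (2 * H))"
  proof -
    have "H * sqrt 2 / (sqrt pi * t powr H) * (scale_mixture \<alpha> c \<phi> x / (2 * H)) =
        sqrt 2 / 2 * (scale_mixture \<alpha> c \<phi> x / (sqrt pi * t powr H))"
      using assms(1) by (simp add: field_simps)
    also have "sqrt 2 / 2 = 1 / sqrt (2::real)" by (simp add: field_simps)
    finally show ?thesis by (simp add: real_sqrt_mult mult_ac)
  qed
  finally show "set_integrable lborel {0<..} ?h \<and>
      u\<^sub>\<alpha> x t = H * sqrt 2 / (sqrt pi * t powr H) * (LINT z:{0<..}|lborel. ?h z)"
    using int val by simp
qed

end
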